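(* Let $X$ be a countably tight (completely regular Hausdorff) space. A subset $A$ of $C_p(X,[0,1])$ is relatively compact in $C_p(X,[0,1])$ if and only if $\mathrm{DULC}(A,X)$ holds.
   Context: $C_p(X,[0,1])$ is the space of continuous functions $X\to[0,1]$ with the pointwise topology. $X$ is countably tight if whenever $B\subseteq X$ and $x\in\overline B$ there is a countable $B_0\subseteq B$ with $x\in\overline{B_0}$. For an ultrafilter $\mathcal U$ on $\omega$ and a sequence $(x_n)$ in a space, $\lim_{n\to\mathcal U}x_n=x$ means $\{n:x_n\in U\}\in\mathcal U$ for every open $U\ni x$. $\mathrm{DULC}(A,X)$ means: for every pair of sequences $(f_n)_{n<\omega}\subseteq A$ and $(x_m)_{m<\omega}\subseteq X$ and ultrafilters $\mathcal U,\mathcal V$ on $\omega$, $\lim_{n\to\mathcal U}\lim_{m\to\mathcal V}f_n(x_m)=\lim_{m\to\mathcal V}\lim_{n\to\mathcal U}f_n(x_m)$ whenever $\lim_{m\to\mathcal V}x_m$ exists in $X$. A subset is relatively compact if its closure is compact. *)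

theory Defs
  imports "HOL-Analysis.Analysis"
begin

definition countably_tight :: "'a topology \<Rightarrow> bool" where
  "countably_tight X \<longleftrightarrow>
     (\<forall>B x. B \<subseteq> topspace X \<and> x \<in> X closure_of B \<longrightarrow>
        (\<exists>B0. B0 \<subseteq> B \<and> countable B0 \<and> x \<in> X closure_of B0))"

(* Functions on topspace X are represented by their extensional representatives
   (value undefined outside topspace X), as everywhere for product_topology. *)
definition Cp01 :: "'a topology \<Rightarrow> ('a \<Rightarrow> real) topology" where
  "Cp01 X = subtopology (product_topology (\<lambda>_. top_of_set {0..1}) (topspace X))
              {f. continuous_map X (top_of_set {0..1}) f}"

(* An ultrafilter is represented by the filter type: a set N belongs to it
   iff eventually (\<lambda>n. n \<in> N) holds. Principal ultrafilters are included. *)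
definition ultrafilter :: "'i filter \<Rightarrow> bool" where
  "ultrafilter F \<longleftrightarrow> F \<noteq> bot \<and> (\<forall>P. eventually P F \<or> eventually (\<lambda>n. \<not> P n) F)"

(* For A contained in topspace (Cp01 X) all the limits below are limits of [0,1]-valued
   sequences along ultrafilters, so they exist and Lim denotes the actual limit. *)
definition DULC :: "('a \<Rightarrow> real) set \<Rightarrow> 'a topology \<Rightarrow> bool" where
  "DULC A X \<longleftrightarrow>
     (\<forall>(f :: nat \<Rightarrow> 'a \<Rightarrow> real) (x :: nat \<Rightarrow> 'a) (\<U> :: nat filter) (\<V> :: nat filter).
        range f \<subseteq> A \<and> range x \<subseteq> topspace X \<and> ultrafilter \<U> \<and> ultrafilter \<V> \<and>
        (\<exists>l. limitin X x l \<V>) \<longrightarrow>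
        Lim \<U> (\<lambda>n. Lim \<V> (\<lambda>m. f n (x m))) = Lim \<V> (\<lambda>m. Lim \<U> (\<lambda>n. f n (x m))))"

definition relatively_compact_in :: "'b topology \<Rightarrow> 'b set \<Rightarrow> bool" where
  "relatively_compact_in Y A \<longleftrightarrow> compactin Y (Y closure_of A)"

end

(* Write P for the full product of copies of [0,1] indexed by X; it is compact, so A is relatively
   compact in Cp01 X as soon as every P-cluster point g of A is continuous. If g were discontinuous
   at a, countable tightness would give a sequence x with an ultrafilter limit a along which g stays
   away from g a. Approximating g on the countable set consisting of a and all x m by a sequence f
   from A makes the two iterated limits equal to g a and to the limit of g (x m), against DULC.
   Conversely, if A is relatively compact, any sequence in A has an ultrafilter limit g that is
   continuous, and both iterated limits are the value of g at the limit of x. *)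
theory Submission
  imports Defs
begin

text \<open>Zorn's lemma gives a minimal proper filter below \<open>F\<close>, and minimality forces
  it to decide every predicate.\<close>

lemma ultrafilter_exists_le:
  assumes "F \<noteq> bot"
  shows "\<exists>G. G \<le> F \<and> ultrafilter G"
proof -
  define C where "C = {G. G \<le> F \<and> G \<noteq> bot}"
  have "\<exists>M\<in>C. \<forall>G\<in>C. G \<le> M \<longrightarrow> G = M"
  \<comment> \<open>The order is reversed, so a maximal element for \<open>(\<ge>)\<close> is a
    finest proper filter.\<close>
  proof (rule predicate_Zorn[where P = "(\<ge>)"])
    show "partial_order_on C (relation_of (\<ge>) C)"
      by (rule partial_order_on_relation_ofI) auto
    fix K assume "K \<in> Chains (relation_of (\<ge>) C)"
    then have K: "K \<subseteq> C" and chain: "\<And>G H. G \<in> K \<Longrightarrow> H \<in> K \<Longrightarrow> G \<le> H \<or> H \<le> G"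
      by (auto simp: Chains_def relation_of_def)
    show "\<exists>u\<in>C. \<forall>G\<in>K. G \<ge> u"
    proof (cases "K = {}")
      case True
      then show ?thesis using assms by (auto simp: C_def)
    next
      case False
      \<comment> \<open>The infimum of a nonempty chain is the union of its filters viewed as
        families of sets, so it cannot contain the empty set unless some member does.\<close>
      have "eventually P (Inf K) \<longleftrightarrow> (\<exists>G\<in>K. eventually P G)" for P
        by (rule eventually_Inf_base) (use False chain in fastforce)+
      then have "Inf K \<noteq> bot"
        using K by (auto simp: trivial_limit_def C_def)
      moreover have "Inf K \<le> F"
        using False K by (metis C_def Inf_lower2 all_not_in_conv mem_Collect_eq subsetD)
      ultimately show ?thesis by (auto simp: C_def intro!: bexI[of _ "Inf K"] Inf_lower)
    qed
  qed
  then obtain M where M: "M \<le> F" "M \<noteq> bot"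
    and min: "\<And>G. G \<le> M \<Longrightarrow> G \<noteq> bot \<Longrightarrow> G = M"
    unfolding C_def using order_trans by blast
  have "eventually P M" if "\<not> eventually (\<lambda>n. \<not> P n) M" for P
  proof -
    \<comment> \<open>Adding the set of \<open>P\<close> to \<open>M\<close> keeps it proper, so by
      minimality it was there already.\<close>
    have "inf M (principal {n. P n}) \<noteq> bot"
      using that by (auto simp: trivial_limit_def eventually_inf_principal)
    then have "inf M (principal {n. P n}) = M" by (intro min) auto
    moreover have "eventually P (inf M (principal {n. P n}))"
      by (simp add: eventually_inf_principal)
    ultimately show ?thesis by simp
  qed
  then show ?thesis using M by (auto simp: ultrafilter_def)
qed

text \<open>If no point of \<open>K\<close> were a limit, each would have an open neighbourhood that
  \<open>f\<close> eventually avoids, because \<open>U\<close> decides membership. Finitely many of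
  these cover \<open>K\<close>, so \<open>f\<close> would eventually avoid \<open>K\<close>.\<close>

lemma ultrafilter_limitin_compactin:
  assumes U: "ultrafilter U" and K: "compactin Y K" and f: "eventually (\<lambda>n. f n \<in> K) U"
  shows "\<exists>l\<in>K. limitin Y f l U"
proof (rule ccontr)
  assume no_limit: "\<not> ?thesis"
  have "\<exists>W. openin Y W \<and> l \<in> W \<and> eventually (\<lambda>n. f n \<notin> W) U" if "l \<in> K" for l
    using no_limit that U compactin_subset_topspace[OF K]
    unfolding limitin_def ultrafilter_def by blast
  then obtain W where W: "\<And>l. l \<in> K \<Longrightarrow> openin Y (W l)" "\<And>l. l \<in> K \<Longrightarrow> l \<in> W l"
      "\<And>l. l \<in> K \<Longrightarrow> eventually (\<lambda>n. f n \<notin> W l) U"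
    by metis
  have "\<exists>\<F>. finite \<F> \<and> \<F> \<subseteq> W ` K \<and> K \<subseteq> \<Union>\<F>"
    by (rule compactinD[OF K]) (use W(1,2) in auto)
  then obtain S where S: "finite S" "S \<subseteq> K" "K \<subseteq> \<Union> (W ` S)"
    by (metis finite_subset_image)
  have "eventually (\<lambda>n. \<forall>l\<in>S. f n \<notin> W l) U"
    using S W(3) by (auto intro!: eventually_ball_finite)
  with f have "eventually (\<lambda>n. False) U"
    by eventually_elim (use S in auto)
  then show False using U by (simp add: ultrafilter_def)
qed

abbreviation cube01 :: "'a topology \<Rightarrow> ('a \<Rightarrow> real) topology" where
  "cube01 X \<equiv> product_topology (\<lambda>_. top_of_set {0..1}) (topspace X)"

lemma topspace_Cp01:
  "topspace (Cp01 X) = topspace (cube01 X) \<inter> {f. continuous_map X (top_of_set {0..1}) f}"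
  by (simp add: Cp01_def)

lemma continuous_map_eval_cube01:
  assumes "y \<in> topspace X"
  shows "continuous_map (cube01 X) euclideanreal (\<lambda>h. h y)"
  using continuous_map_product_projection[OF assms, of "\<lambda>_. top_of_set {0..1::real}"]
  by (rule continuous_map_into_fulltopology)

lemma continuous_map_topspace_Cp01:
  "f \<in> topspace (Cp01 X) \<Longrightarrow> continuous_map X euclideanreal f"
  by (auto simp: topspace_Cp01 intro: continuous_map_into_fulltopology)

lemma tendsto_continuous_map_limitin:
  assumes "continuous_map X euclideanreal g" "limitin X x a F"
  shows "((\<lambda>m. g (x m)) \<longlongrightarrow> g a) F"
  using continuous_map_limit[OF assms] by (simp add: o_def)

lemma closure_of_cube01_approx:
  assumes g: "g \<in> cube01 X closure_of A" and S: "finite S" "S \<subseteq> topspace X" and e: "e > 0"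
  shows "\<exists>f\<in>A. \<forall>y\<in>S. \<bar>f y - g y\<bar> < e"
proof -
  \<comment> \<open>A finite sum of coordinate distances is continuous on the cube and bounds each
    single distance, so \<open>d h < e\<close> describes a suitable neighbourhood of
    \<open>g\<close>.\<close>
  define d where "d h = (\<Sum>y\<in>S. \<bar>h y - g y\<bar>)" for h
  have "continuous_map (cube01 X) euclideanreal d"
    unfolding d_def using S
    by (intro continuous_map_sum continuous_map_real_abs continuous_map_diff
          continuous_map_eval_cube01) auto
  then have "openin (cube01 X) {h \<in> topspace (cube01 X). d h \<in> {..<e}}" (is "openin _ ?N")
    by (rule openin_continuous_map_preimage) simp
  moreover have "g \<in> ?N"
    using g e by (simp add: d_def in_closure_of)
  ultimately have "\<exists>f. f \<in> A \<and> f \<in> ?N"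
    using g[unfolded in_closure_of] by (elim conjE allE[where x = ?N]) (rule mp, auto)
  then obtain f where f: "f \<in> A" "d f < e"
    by auto
  have "\<bar>f y - g y\<bar> \<le> d f" if "y \<in> S" for y
    unfolding d_def using S that by (intro member_le_sum) auto
  then show ?thesis
    using f by (intro bexI[of _ f] ballI) (auto intro: le_less_trans)
qed

lemma relatively_compact_imp_DULC:
  assumes A: "A \<subseteq> topspace (Cp01 X)" and rc: "relatively_compact_in (Cp01 X) A"
  shows "DULC A X"
  unfolding DULC_def
proof (intro allI impI, elim conjE exE)
  fix f :: "nat \<Rightarrow> 'a \<Rightarrow> real" and x :: "nat \<Rightarrow> 'a" and \<U> \<V> :: "nat filter" and a
  assume f: "range f \<subseteq> A" and x: "range x \<subseteq> topspace X"
    and U: "ultrafilter \<U>" and V: "ultrafilter \<V>" and a: "limitin X x a \<V>"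
  have nontrivial: "\<U> \<noteq> bot" "\<V> \<noteq> bot" using U V by (auto simp: ultrafilter_def)
  have fK: "f n \<in> Cp01 X closure_of A" for n
    using f closure_of_subset[OF A] by blast
  \<comment> \<open>The closure is compact and contains all \<open>f n\<close>; it lies in
    \<open>Cp01 X\<close>, which makes the limit \<open>g\<close> continuous.\<close>
  obtain g where g: "g \<in> Cp01 X closure_of A" "limitin (Cp01 X) f g \<U>"
    using ultrafilter_limitin_compactin[OF U rc[unfolded relatively_compact_in_def], of f] fK
    by auto
  have g_cont: "continuous_map X euclideanreal g"
    using g(1) by (auto simp: in_closure_of intro: continuous_map_topspace_Cp01)
  have f_cont: "continuous_map X euclideanreal (f n)" for n
    using f A by (auto intro!: continuous_map_topspace_Cp01)
  have lim_f: "((\<lambda>n. f n y) \<longlongrightarrow> g y) \<U>" if "y \<in> topspace X" for y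
    by (rule tendsto_continuous_map_limitin[OF _ g(2)])
       (unfold Cp01_def, intro continuous_map_from_subtopology continuous_map_eval_cube01 that)
  have a_in: "a \<in> topspace X" using a by (simp add: limitin_def)
  \<comment> \<open>The left iterated limit reaches \<open>g a\<close> by continuity of each
    \<open>f n\<close>, then convergence at \<open>a\<close>; the right one by convergence at each
    \<open>x m\<close>, then continuity of \<open>g\<close>.\<close>
  have "Lim \<V> (\<lambda>m. f n (x m)) = f n a" for n
    by (intro tendsto_Lim nontrivial tendsto_continuous_map_limitin[OF f_cont a])
  moreover have "Lim \<U> (\<lambda>n. f n (x m)) = g (x m)" for m
    using x by (intro tendsto_Lim nontrivial lim_f) auto
  moreover have "Lim \<U> (\<lambda>n. f n a) = g a"
    by (intro tendsto_Lim nontrivial lim_f a_in)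
  moreover have "Lim \<V> (\<lambda>m. g (x m)) = g a"
    by (intro tendsto_Lim nontrivial tendsto_continuous_map_limitin[OF g_cont a])
  ultimately show "Lim \<U> (\<lambda>n. Lim \<V> (\<lambda>m. f n (x m))) = Lim \<V> (\<lambda>m. Lim \<U> (\<lambda>n. f n (x m)))"
    by simp
qed

lemma ultrafilter_limitin_range:
  assumes a: "a \<in> X closure_of (range x)"
  shows "\<exists>V. ultrafilter V \<and> limitin X x a V"
proof -
  \<comment> \<open>\<open>F\<close> is generated by the index sets of the terms lying in a
    neighbourhood of \<open>a\<close>; any ultrafilter refining it makes \<open>x\<close> converge
    to \<open>a\<close>.\<close>
  define F where "F = filtercomap x (nhdsin X a)"
  have a_in: "a \<in> topspace X" using a by (simp add: in_closure_of)
  have ev: "eventually P F \<longleftrightarrow> (\<exists>W. openin X W \<and> a \<in> W \<and> (\<forall>m. x m \<in> W \<longrightarrow> P m))" for P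
  proof
    assume "eventually P F"
    then show "\<exists>W. openin X W \<and> a \<in> W \<and> (\<forall>m. x m \<in> W \<longrightarrow> P m)"
      using a_in unfolding F_def eventually_filtercomap eventually_nhdsin by metis
  next
    assume "\<exists>W. openin X W \<and> a \<in> W \<and> (\<forall>m. x m \<in> W \<longrightarrow> P m)"
    then obtain W where "openin X W" "a \<in> W" "\<forall>m. x m \<in> W \<longrightarrow> P m" by blast
    then show "eventually P F"
      unfolding F_def eventually_filtercomap eventually_nhdsin
      by (intro exI[of _ "\<lambda>y. y \<in> W"]) blast
  qed
  \<comment> \<open>Every neighbourhood of \<open>a\<close> meets the range of \<open>x\<close>, so
    no generating index set is empty.\<close>
  have "F \<noteq> bot"
    using a by (fastforce simp: trivial_limit_def ev in_closure_of)
  then obtain V where V: "V \<le> F" "ultrafilter V"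
    using ultrafilter_exists_le by blast
  have "limitin X x a V"
    using a_in by (auto simp: limitin_def intro!: filter_leD[OF V(1)] simp: ev)
  with V show ?thesis by blast
qed

lemma discontinuous_imp_sequence:
  fixes g :: "'a \<Rightarrow> real"
  assumes tight: "countably_tight X" and g: "\<not> continuous_map X euclideanreal g"
  shows "\<exists>a x e. e > 0 \<and> range x \<subseteq> topspace X \<and> a \<in> X closure_of (range x) \<and>
           (\<forall>m::nat. e \<le> \<bar>g (x m) - g a\<bar>)"
proof -
  obtain a W where a: "a \<in> topspace X" and W: "open W" "g a \<in> W"
    and bad: "\<And>T. openin X T \<Longrightarrow> a \<in> T \<Longrightarrow> \<exists>y\<in>T. g y \<notin> W"
    using g unfolding continuous_map_eq_topcontinuous_at topcontinuous_at_def by auto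
  obtain e where e: "e > 0" "\<And>t. \<bar>t - g a\<bar> < e \<Longrightarrow> t \<in> W"
    using W unfolding open_dist dist_real_def by blast
  \<comment> \<open>Discontinuity at \<open>a\<close> places \<open>a\<close> in the closure of this
    set; countable tightness then cuts it down to a countable subset.\<close>
  define B where "B = {y \<in> topspace X. e \<le> \<bar>g y - g a\<bar>}"
  have "a \<in> X closure_of B"
    unfolding in_closure_of B_def
  proof (intro conjI allI impI a; elim conjE)
    fix T assume "a \<in> T" "openin X T"
    then obtain y where "y \<in> T" "g y \<notin> W" using bad by blast
    then show "\<exists>y. y \<in> {y \<in> topspace X. e \<le> \<bar>g y - g a\<bar>} \<and> y \<in> T"
      using e(2)[of "g y"] openin_subset[OF \<open>openin X T\<close>] by force
  qed
  moreover have "B \<subseteq> topspace X" by (auto simp: B_def)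
  ultimately obtain B0 where B0: "B0 \<subseteq> B" "countable B0" "a \<in> X closure_of B0"
    using tight[unfolded countably_tight_def, rule_format, of B a] by auto
  \<comment> \<open>A nonempty countable set is the range of a sequence, with repetitions if it is
    finite.\<close>
  have "B0 \<noteq> {}" using B0(3) by auto
  then obtain x :: "nat \<Rightarrow> 'a" where x: "B0 = range x"
    using B0(2) uncountable_def by blast
  have "x m \<in> B" for m using B0(1) x by blast
  then have "range x \<subseteq> topspace X" "\<forall>m. e \<le> \<bar>g (x m) - g a\<bar>" by (auto simp: B_def)
  with e(1) B0(3) x show ?thesis by blast
qed

lemma DULC_imp_closure_continuous:
  assumes tight: "countably_tight X" and A: "A \<subseteq> topspace (Cp01 X)" and dulc: "DULC A X"
    and g: "g \<in> cube01 X closure_of A"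
  shows "continuous_map X euclideanreal g"
proof (rule ccontr)
  assume "\<not> continuous_map X euclideanreal g"
  then obtain a e and x :: "nat \<Rightarrow> 'a" where e: "e > 0" and x: "range x \<subseteq> topspace X"
    and acl: "a \<in> X closure_of (range x)" and far: "\<And>m. e \<le> \<bar>g (x m) - g a\<bar>"
    using discontinuous_imp_sequence[OF tight] by metis
  obtain V where V: "ultrafilter V" "limitin X x a V"
    using ultrafilter_limitin_range[OF acl] by blast
  \<comment> \<open>Choosing \<open>U\<close> below \<open>sequentially\<close> lets ordinary
    sequential limits pass to \<open>U\<close>.\<close>
  obtain U :: "nat filter" where U: "U \<le> sequentially" "ultrafilter U"
    using ultrafilter_exists_le[OF sequentially_bot] by blast
  have nontrivial: "U \<noteq> bot" "V \<noteq> bot" using U V by (auto simp: ultrafilter_def)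
  have a_in: "a \<in> topspace X" using acl by (simp add: in_closure_of)
  \<comment> \<open>Stage \<open>n\<close> controls only finitely many points, but each
    \<open>x m\<close> is included from stage \<open>m\<close> on and \<open>a\<close> always, while
    the tolerance tends to 0.\<close>
  have "\<exists>f\<in>A. \<forall>y \<in> insert a (x ` {..n}). \<bar>f y - g y\<bar> < inverse (real (Suc n))" for n
    using x a_in by (intro closure_of_cube01_approx[OF g]) auto
  then obtain f where f: "\<And>n. f n \<in> A"
    and approx: "\<And>n y. y \<in> insert a (x ` {..n}) \<Longrightarrow> \<bar>f n y - g y\<bar> < inverse (real (Suc n))"
    by metis
  have lim_f: "((\<lambda>n. f n y) \<longlongrightarrow> g y) U" if "y \<in> insert a (range x)" for y
  proof (rule tendsto_mono[OF U(1)], rule LIM_zero_cancel)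
    have "\<exists>k. \<forall>n\<ge>k. y \<in> insert a (x ` {..n})"
      using that by auto
    then obtain k where "\<And>n. n \<ge> k \<Longrightarrow> y \<in> insert a (x ` {..n})"
      by blast
    then have "\<forall>\<^sub>F n in sequentially. norm (f n y - g y) \<le> inverse (real (Suc n))"
      using approx by (auto simp: eventually_sequentially intro!: exI[of _ k] less_imp_le)
    then show "(\<lambda>n. f n y - g y) \<longlonglongrightarrow> 0"
      by (rule Lim_null_comparison) (rule LIMSEQ_inverse_real_of_nat)
  qed
  \<comment> \<open>Boundedness alone gives the limit \<open>l\<close> along \<open>V\<close>,
    although \<open>g\<close> is discontinuous.\<close>
  have "\<forall>m. g (x m) \<in> {0..1}"
    using g x by (auto simp: in_closure_of PiE_iff)
  then obtain l where l: "((\<lambda>m. g (x m)) \<longlongrightarrow> l) V"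
    using ultrafilter_limitin_compactin[OF V(1), of euclideanreal "{0..1}" "\<lambda>m. g (x m)"] by auto
  have "Lim V (\<lambda>m. f n (x m)) = f n a" for n
    using f A V(2)
    by (intro tendsto_Lim nontrivial tendsto_continuous_map_limitin
          continuous_map_topspace_Cp01) auto
  moreover have "Lim U (\<lambda>n. f n (x m)) = g (x m)" for m
    by (intro tendsto_Lim nontrivial lim_f) auto
  moreover have "Lim U (\<lambda>n. f n a) = g a"
    by (intro tendsto_Lim nontrivial lim_f) auto
  moreover have "Lim U (\<lambda>n. Lim V (\<lambda>m. f n (x m))) = Lim V (\<lambda>m. Lim U (\<lambda>n. f n (x m)))"
    using dulc f x U(2) V unfolding DULC_def by blast
  ultimately have "g a = l"
    using tendsto_Lim[OF nontrivial(2) l] by simp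
  \<comment> \<open>The gap \<open>e\<close> survives in the limit and contradicts
    \<open>g a = l\<close>.\<close>
  moreover have "e \<le> \<bar>l - g a\<bar>"
    by (rule tendsto_lowerbound[where f = "\<lambda>m. \<bar>g (x m) - g a\<bar>", OF _ _ nontrivial(2)])
       (use l far in \<open>auto intro!: tendsto_intros\<close>)
  ultimately show False using e by simp
qed

text \<open>When the closure in the cube consists of continuous functions, it equals the closure in
  \<open>Cp01 X\<close>, and it is compact as a closed subset of the cube, by Tychonoff.\<close>

lemma closure_continuous_imp_relatively_compact:
  assumes A: "A \<subseteq> topspace (Cp01 X)"
    and cont: "\<And>g. g \<in> cube01 X closure_of A \<Longrightarrow> continuous_map X euclideanreal g"
  shows "relatively_compact_in (Cp01 X) A"
proof -
  let ?C = "{f. continuous_map X (top_of_set {0..1::real}) f}"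
  \<comment> \<open>The hypothesis gives continuity into the reals; the bounds 0 and 1 come from
    membership in the cube.\<close>
  have sub: "cube01 X closure_of A \<subseteq> ?C"
    using cont by (auto simp: continuous_map_in_subtopology in_closure_of PiE_iff)
  have "?C \<inter> A = A" using A by (auto simp: topspace_Cp01)
  then have "Cp01 X closure_of A = cube01 X closure_of A"
    using sub by (auto simp: Cp01_def closure_of_subtopology)
  moreover have "compact_space (cube01 X)"
    by (simp add: compact_space_product_topology compact_space_subtopology)
  then have "compactin (cube01 X) (cube01 X closure_of A)"
    by (simp add: closedin_compact_space)
  ultimately show ?thesis
    using sub by (simp add: relatively_compact_in_def Cp01_def compactin_subtopology)
qed

theorem theorem4p9:
  fixes X :: "'a topology" and A :: "('a \<Rightarrow> real) set"
  assumes "completely_regular_space X"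
    and "Hausdorff_space X"
    and "countably_tight X"
    and "A \<subseteq> topspace (Cp01 X)"
  shows "relatively_compact_in (Cp01 X) A \<longleftrightarrow> DULC A X"
proof
  show "DULC A X" if "relatively_compact_in (Cp01 X) A"
    using assms(4) that by (rule relatively_compact_imp_DULC)
  show "relatively_compact_in (Cp01 X) A" if "DULC A X"
    using assms(4) DULC_imp_closure_continuous[OF assms(3,4) that]
    by (rule closure_continuous_imp_relatively_compact)
qed

end
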